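(* Let $G=(V,E)$ be a finite (not necessarily planar) graph, and let the coupling constants satisfy $J_e\ge0$, $U_e\le0$ and $\cosh(2J_e)\ge e^{-2U_e}$ for all $e\in E$. Let $u,v\in V$ be distinct vertices, and let $W\subset V$ separate $u$ from $v$, i.e. every path from $u$ to $v$ in $G$ intersects $W$. Then in the Ashkin--Teller model on $G$, $$\langle\sigma_u\sigma_v\rangle\le\sum_{w\in W}\langle\sigma_u\sigma_w\rangle\langle\sigma_w\sigma_v\rangle .$$
   Context: The Ashkin--Teller model (free boundary conditions) on a finite graph $G=(V,E)$ with real coupling constants $J_e,U_e$ is the probability measure on pairs $(\sigma,\tilde\sigma)\in\{-1,1\}^V\times\{-1,1\}^V$ given by $$\mathbf P(\sigma,\tilde\sigma)=\frac1{\mathcal Z}\prod_{uv\in E}\exp\big(J_{uv}(\sigma_u\sigma_v+\tilde\sigma_u\tilde\sigma_v)+U_{uv}(\sigma_u\sigma_v\tilde\sigma_u\tilde\sigma_v+1)\big),$$ with $\mathcal Z$ the normalizing constant; $\langle\cdot\rangle$ is the expectation. *)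

theory Defs
  imports "HOL-Probability.Probability"
begin

definition finite_graph :: "'a set \<Rightarrow> 'a set set \<Rightarrow> bool" where
  "finite_graph V E \<longleftrightarrow> finite V \<and> (\<forall>e\<in>E. e \<subseteq> V \<and> card e = 2)"

definition is_path :: "'a set set \<Rightarrow> 'a \<Rightarrow> 'a \<Rightarrow> 'a list \<Rightarrow> bool" where
  "is_path E u v p \<longleftrightarrow> p \<noteq> [] \<and> hd p = u \<and> last p = v \<and> distinct p
     \<and> successively (\<lambda>x y. {x, y} \<in> E) p"

text \<open>The endpoints count as vertices of a path, so a separating set may contain them.\<close>

definition separates :: "'a set set \<Rightarrow> 'a set \<Rightarrow> 'a \<Rightarrow> 'a \<Rightarrow> bool" where
  "separates E W u v \<longleftrightarrow> (\<forall>p. is_path E u v p \<longrightarrow> set p \<inter> W \<noteq> {})"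

definition spin_configs :: "'a set \<Rightarrow> ('a \<Rightarrow> real) set" where
  "spin_configs V = V \<rightarrow>\<^sub>E {-1, 1}"

text \<open>For an edge \<open>e = {x, y}\<close> with \<open>x \<noteq> y\<close> this is \<open>\<sigma> x * \<sigma> y\<close>.\<close>

definition edge_spin :: "('a \<Rightarrow> real) \<Rightarrow> 'a set \<Rightarrow> real" where
  "edge_spin \<sigma> e = (\<Prod>x\<in>e. \<sigma> x)"

lemma edge_spin_pair: "x \<noteq> y \<Longrightarrow> edge_spin \<sigma> {x, y} = \<sigma> x * \<sigma> y"
  by (simp add: edge_spin_def)

definition AT_weight ::
    "'a set set \<Rightarrow> ('a set \<Rightarrow> real) \<Rightarrow> ('a set \<Rightarrow> real) \<Rightarrow> ('a \<Rightarrow> real) \<times> ('a \<Rightarrow> real) \<Rightarrow> real" where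
  "AT_weight E J U = (\<lambda>(\<sigma>, \<sigma>'). \<Prod>e\<in>E.
     exp (J e * (edge_spin \<sigma> e + edge_spin \<sigma>' e)
          + U e * (edge_spin \<sigma> e * edge_spin \<sigma>' e + 1)))"

definition AT_partition ::
    "'a set \<Rightarrow> 'a set set \<Rightarrow> ('a set \<Rightarrow> real) \<Rightarrow> ('a set \<Rightarrow> real) \<Rightarrow> real" where
  "AT_partition V E J U = (\<Sum>\<omega>\<in>spin_configs V \<times> spin_configs V. AT_weight E J U \<omega>)"

definition AT_measure ::
    "'a set \<Rightarrow> 'a set set \<Rightarrow> ('a set \<Rightarrow> real) \<Rightarrow> ('a set \<Rightarrow> real)
      \<Rightarrow> (('a \<Rightarrow> real) \<times> ('a \<Rightarrow> real)) measure" where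
  "AT_measure V E J U = point_measure (spin_configs V \<times> spin_configs V)
     (\<lambda>\<omega>. ennreal (AT_weight E J U \<omega> / AT_partition V E J U))"

definition AT_expectation ::
    "'a set \<Rightarrow> 'a set set \<Rightarrow> ('a set \<Rightarrow> real) \<Rightarrow> ('a set \<Rightarrow> real)
      \<Rightarrow> (('a \<Rightarrow> real) \<times> ('a \<Rightarrow> real) \<Rightarrow> real) \<Rightarrow> real" where
  "AT_expectation V E J U f = (\<integral>\<omega>. f \<omega> \<partial>AT_measure V E J U)"

definition AT_corr ::
    "'a set \<Rightarrow> 'a set set \<Rightarrow> ('a set \<Rightarrow> real) \<Rightarrow> ('a set \<Rightarrow> real) \<Rightarrow> 'a \<Rightarrow> 'a \<Rightarrow> real" where
  "AT_corr V E J U x y = AT_expectation V E J U (\<lambda>(\<sigma>, \<sigma>'). \<sigma> x * \<sigma> y)"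

lemma finite_spin_configs: "finite V \<Longrightarrow> finite (spin_configs V)"
  unfolding spin_configs_def by (intro finite_PiE) auto

lemma spin_configs_nonempty: "spin_configs V \<noteq> {}"
  by (simp add: spin_configs_def PiE_eq_empty_iff)

lemma AT_weight_pos: "AT_weight E J U \<omega> > 0"
  by (cases \<omega>) (simp add: AT_weight_def prod_pos)

lemma AT_partition_pos: "finite V \<Longrightarrow> AT_partition V E J U > 0"
  unfolding AT_partition_def
  by (intro sum_pos) (auto simp: finite_spin_configs spin_configs_nonempty AT_weight_pos)

lemma prob_space_AT_measure:
  assumes "finite V"
  shows "prob_space (AT_measure V E J U)"
proof
  let ?C = "spin_configs V \<times> spin_configs V" and ?Z = "AT_partition V E J U"
  have fin: "finite ?C" using assms by (simp add: finite_spin_configs)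
  have nn: "0 \<le> AT_weight E J U \<omega> / ?Z" for \<omega>
    using AT_partition_pos[OF assms, of E J U] AT_weight_pos[of E J U \<omega>] by simp
  have "emeasure (AT_measure V E J U) (space (AT_measure V E J U))
      = (\<Sum>\<omega>\<in>?C. ennreal (AT_weight E J U \<omega> / ?Z))"
    unfolding AT_measure_def space_point_measure
    by (rule emeasure_point_measure_finite[OF fin]) simp
  also have "\<dots> = ennreal (\<Sum>\<omega>\<in>?C. AT_weight E J U \<omega> / ?Z)"
    by (intro sum_ennreal nn)
  also have "(\<Sum>\<omega>\<in>?C. AT_weight E J U \<omega> / ?Z) = ?Z / ?Z"
    unfolding sum_divide_distrib[symmetric] AT_partition_def by (rule refl)
  finally show "emeasure (AT_measure V E J U) (space (AT_measure V E J U)) = 1"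
    using AT_partition_pos[OF assms, of E J U] by simp
qed

lemma AT_expectation_eq_sum:
  assumes "finite V"
  shows "AT_expectation V E J U f =
    (\<Sum>\<omega>\<in>spin_configs V \<times> spin_configs V. AT_weight E J U \<omega> / AT_partition V E J U * f \<omega>)"
  unfolding AT_expectation_def AT_measure_def
  using assms AT_partition_pos[OF assms, of E J U] AT_weight_pos[of E J U]
  by (subst lebesgue_integral_point_measure_finite)
     (auto simp: finite_spin_configs less_imp_le)

end

theory Submission
  imports Defs
begin

text \<open>Let \<open>\<tau> = \<sigma> \<sigma>'\<close>. For fixed \<open>\<tau>\<close> an edge weight is affine in the edge spin of \<open>\<sigma>\<close>: it is
  \<open>a + c \<tau>\<^sub>e + b (1 + \<tau>\<^sub>e) \<sigma>\<^sub>e\<close> with \<open>b \<ge> 0\<close> since \<open>J \<ge> 0\<close> and \<open>c \<ge> 0\<close> since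
  \<open>cosh (2 J) \<ge> exp (- 2 U)\<close>. Expand over the set \<open>D\<close> of edges carrying the odd term. Summing over
  \<open>\<sigma>\<close> kills \<open>D\<close> unless it joins \<open>u\<close> to \<open>v\<close>, hence some \<open>w \<in> W\<close> to \<open>v\<close>; the factors \<open>1 + \<tau>\<^sub>e\<close>
  then force \<open>\<tau>\<^sub>w \<tau>\<^sub>v = 1\<close>. As all other \<open>\<tau>\<^sub>w \<tau>\<^sub>v\<close> contribute nonnegatively by Griffiths' first
  inequality, the correlation of \<open>u\<close> and \<open>v\<close> is at most the sum over \<open>w\<close> of the mixed correlations
  \<open>\<langle>\<sigma>\<^sub>u \<sigma>\<^sub>w \<sigma>'\<^sub>w \<sigma>'\<^sub>v\<rangle>\<close>.

  For \<open>U \<le> 0\<close> the mixed correlation is at most the product of the two correlations, by Ginibre's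
  method: duplicate the system as \<open>(s, t), (s', t')\<close> and put \<open>p = (s + s') / 2\<close>,
  \<open>m = (s - s') / 2\<close>, \<open>q = (t' + t) / 2\<close>, \<open>n = (t' - t) / 2\<close> at each site. The duplicated weight and
  \<open>(s\<^sub>A - s'\<^sub>A) (t'\<^sub>B - t\<^sub>B)\<close> are polynomials in these variables with nonnegative coefficients, and
  every monomial has a nonnegative sum.\<close>

section \<open>Cones spanned by monomials\<close>

text \<open>Finite nonnegative combinations of \<open>M\<close>, built one term at a time so that
  closure and positivity follow by induction.\<close>

inductive_set monomial_cone :: "('b \<Rightarrow> real) set \<Rightarrow> ('b \<Rightarrow> real) set"
  for M :: "('b \<Rightarrow> real) set" where
  zero: "(\<lambda>_. 0) \<in> monomial_cone M"
| step: "f \<in> monomial_cone M \<Longrightarrow> g \<in> M \<Longrightarrow> 0 \<le> c \<Longrightarrow> (\<lambda>x. f x + c * g x) \<in> monomial_cone M"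

lemma monomial_cone_base: "g \<in> M \<Longrightarrow> g \<in> monomial_cone M"
  using monomial_cone.step[OF monomial_cone.zero, of g M 1] by simp

lemma monomial_cone_add:
  assumes "f \<in> monomial_cone M" "g \<in> monomial_cone M"
  shows "(\<lambda>x. f x + g x) \<in> monomial_cone M"
  using assms(2)
proof induction
  case zero
  then show ?case using assms(1) by simp
next
  case (step h g c)
  from monomial_cone.step[OF step.IH step.hyps(2,3)] show ?case by (simp add: add_ac)
qed

lemma monomial_cone_scale:
  assumes "f \<in> monomial_cone M" "0 \<le> c"
  shows "(\<lambda>x. c * f x) \<in> monomial_cone M"
  using assms(1)
proof induction
  case zero
  then show ?case by (simp add: monomial_cone.zero)
next
  case (step h g d)
  have "0 \<le> c * d" using step.hyps(3) assms(2) by simp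
  from monomial_cone.step[OF step.IH step.hyps(2) this] show ?case
    by (simp add: algebra_simps)
qed

lemma monomial_cone_sum_nonneg:
  assumes "f \<in> monomial_cone M" and "\<And>g. g \<in> M \<Longrightarrow> 0 \<le> sum g A"
  shows "0 \<le> sum f A"
  using assms(1)
proof induction
  case (step h g c)
  then show ?case
    using assms(2)[of g] by (simp add: sum.distrib sum_distrib_left[symmetric])
qed simp

text \<open>Closure under products makes the cone of \<open>M\<close> a semiring, so membership of a
  polynomial expression can be checked factor by factor.\<close>

locale monomials =
  fixes M :: "('b \<Rightarrow> real) set"
  assumes one: "(\<lambda>_. 1) \<in> M"
    and times: "\<And>f g. f \<in> M \<Longrightarrow> g \<in> M \<Longrightarrow> (\<lambda>x. f x * g x) \<in> M"
begin

lemma cone_const: "0 \<le> c \<Longrightarrow> (\<lambda>_. c) \<in> monomial_cone M"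
  using monomial_cone_scale[OF monomial_cone_base[OF one], of c] by simp

lemma cone_times_monomial:
  assumes "f \<in> monomial_cone M" "h \<in> M"
  shows "(\<lambda>x. f x * h x) \<in> monomial_cone M"
  using assms(1)
proof induction
  case zero
  then show ?case by (simp add: monomial_cone.zero)
next
  case (step f g c)
  from monomial_cone.step[OF step.IH times[OF step.hyps(2) assms(2)] step.hyps(3)]
  show ?case by (simp add: algebra_simps)
qed

lemma cone_times:
  assumes "f \<in> monomial_cone M" "g \<in> monomial_cone M"
  shows "(\<lambda>x. f x * g x) \<in> monomial_cone M"
  using assms(2)
proof induction
  case zero
  then show ?case by (simp add: monomial_cone.zero)
next
  case (step h g c)
  from monomial_cone_add[OF step.IH
      monomial_cone_scale[OF cone_times_monomial[OF assms(1) step.hyps(2)] step.hyps(3)]]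
  show ?case by (simp add: algebra_simps)
qed

lemma cone_prod:
  assumes "\<And>i. i \<in> I \<Longrightarrow> f i \<in> monomial_cone M"
  shows "(\<lambda>x. \<Prod>i\<in>I. f i x) \<in> monomial_cone M"
proof (cases "finite I")
  case True
  then show ?thesis using assms
    by (induction I) (auto intro: cone_const cone_times)
qed (simp add: cone_const)

end

section \<open>Griffiths' first inequality\<close>

text \<open>Exponents are not reduced modulo 2: the functions live on all real-valued assignments,
  where squares need not be 1, and products simply add exponents.\<close>

definition spin_monomials :: "'a set \<Rightarrow> (('a \<Rightarrow> real) \<Rightarrow> real) set" where
  "spin_monomials V = {f. \<exists>k :: 'a \<Rightarrow> nat. f = (\<lambda>\<sigma>. \<Prod>x\<in>V. \<sigma> x ^ k x)}"

interpretation spin: monomials "spin_monomials V" for V :: "'a set"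
proof
  show "(\<lambda>_. 1) \<in> spin_monomials V"
    unfolding spin_monomials_def by (auto intro!: exI[of _ "\<lambda>_. 0"])
next
  fix f g assume "f \<in> spin_monomials V" "g \<in> spin_monomials V"
  then obtain k l where "f = (\<lambda>\<sigma>. \<Prod>x\<in>V. \<sigma> x ^ k x)" "g = (\<lambda>\<sigma>. \<Prod>x\<in>V. \<sigma> x ^ l x)"
    unfolding spin_monomials_def by auto
  then show "(\<lambda>\<sigma>. f \<sigma> * g \<sigma>) \<in> spin_monomials V"
    unfolding spin_monomials_def
    by (auto simp: power_add prod.distrib intro!: exI[of _ "\<lambda>x. k x + l x"])
qed

lemma prod_power_indicator:
  fixes f :: "'a \<Rightarrow> real"
  assumes "finite V" "x \<in> V"
  shows "(\<Prod>y\<in>V. f y ^ (if y = x then 1 else 0)) = f x"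
proof -
  have "(\<Prod>y\<in>V. f y ^ (if y = x then 1 else 0)) = (\<Prod>y\<in>V. if y = x then f y else 1)"
    by (intro prod.cong) auto
  then show ?thesis using assms by (simp add: prod.delta)
qed

lemma spin_in_cone:
  assumes "finite V" "x \<in> V"
  shows "(\<lambda>\<sigma>. \<sigma> x) \<in> monomial_cone (spin_monomials V)"
proof (rule monomial_cone_base)
  show "(\<lambda>\<sigma>. \<sigma> x) \<in> spin_monomials V"
    unfolding spin_monomials_def
    using prod_power_indicator[OF assms] by (fastforce intro!: exI[of _ "\<lambda>y. if y = x then 1 else 0"])
qed

lemma edge_spin_in_cone:
  assumes "finite V" "e \<subseteq> V"
  shows "(\<lambda>\<sigma>. edge_spin \<sigma> e) \<in> monomial_cone (spin_monomials V)"
  unfolding edge_spin_def using assms by (intro spin.cone_prod) (auto intro: spin_in_cone)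

text \<open>The sum of a monomial factorises over sites, and a site with exponent \<open>k\<close>
  contributes \<open>(-1) ^ k + 1\<close>, which is 0 or 2.\<close>

lemma Griffiths_first:
  assumes "finite V" "f \<in> monomial_cone (spin_monomials V)"
  shows "0 \<le> (\<Sum>\<sigma>\<in>spin_configs V. f \<sigma>)"
proof (rule monomial_cone_sum_nonneg[OF assms(2)])
  fix g assume "g \<in> spin_monomials V"
  then obtain k where g: "g = (\<lambda>\<sigma>. \<Prod>x\<in>V. \<sigma> x ^ k x)" unfolding spin_monomials_def by auto
  have "sum g (spin_configs V) = (\<Prod>x\<in>V. \<Sum>s\<in>{-1, 1::real}. s ^ k x)"
    unfolding spin_configs_def g using assms(1) by (subst prod_sum_PiE) auto
  also have "\<dots> \<ge> 0"
    by (intro prod_nonneg) (auto simp: minus_one_power_iff)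
  finally show "0 \<le> sum g (spin_configs V)" .
qed

section \<open>Ginibre's duplicated spins\<close>

text \<open>The second copy of the pair \<open>(t, t')\<close> comes first, so that the difference variable is
  \<open>(t' - t) / 2\<close>: this sign makes a negative \<open>U\<close> contribute positively.\<close>

definition pair_monomial ::
    "'a set \<Rightarrow> ('a \<Rightarrow> nat) \<Rightarrow> ('a \<Rightarrow> nat) \<Rightarrow> ('a \<Rightarrow> real) \<Rightarrow> ('a \<Rightarrow> real) \<Rightarrow> real" where
  "pair_monomial V k l s s' = (\<Prod>x\<in>V. ((s x + s' x) / 2) ^ k x * ((s x - s' x) / 2) ^ l x)"

definition ginibre_monomials ::
    "'a set \<Rightarrow> (('a \<Rightarrow> real) \<times> ('a \<Rightarrow> real) \<times> ('a \<Rightarrow> real) \<times> ('a \<Rightarrow> real) \<Rightarrow> real) set" where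
  "ginibre_monomials V = {f. \<exists>k l m n.
     f = (\<lambda>(s, s', t, t'). pair_monomial V k l s s' * pair_monomial V m n t' t)}"

lemma pair_monomial_zero: "pair_monomial V (\<lambda>_. 0) (\<lambda>_. 0) s s' = 1"
  by (simp add: pair_monomial_def)

lemma pair_monomial_times:
  "pair_monomial V k l s s' * pair_monomial V m n s s'
     = pair_monomial V (\<lambda>x. k x + m x) (\<lambda>x. l x + n x) s s'"
  unfolding pair_monomial_def prod.distrib[symmetric]
  by (intro prod.cong) (auto simp: power_add)

interpretation ginibre: monomials "ginibre_monomials V" for V :: "'a set"
proof
  show "(\<lambda>_. 1) \<in> ginibre_monomials V"
    unfolding ginibre_monomials_def
    by (auto intro!: exI[of _ "\<lambda>_. 0"] simp: pair_monomial_zero fun_eq_iff)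
next
  fix f g assume "f \<in> ginibre_monomials V" "g \<in> ginibre_monomials V"
  then obtain k l m n k' l' m' n' where
    f: "f = (\<lambda>(s, s', t, t'). pair_monomial V k l s s' * pair_monomial V m n t' t)" and
    g: "g = (\<lambda>(s, s', t, t'). pair_monomial V k' l' s s' * pair_monomial V m' n' t' t)"
    unfolding ginibre_monomials_def by auto
  have "(\<lambda>x. f x * g x) = (\<lambda>(s, s', t, t').
      pair_monomial V (\<lambda>x. k x + k' x) (\<lambda>x. l x + l' x) s s'
      * pair_monomial V (\<lambda>x. m x + m' x) (\<lambda>x. n x + n' x) t' t)"
    unfolding f g by (auto simp: fun_eq_iff pair_monomial_times[symmetric])
  then show "(\<lambda>x. f x * g x) \<in> ginibre_monomials V"
    unfolding ginibre_monomials_def by blast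
qed

text \<open>The sum factorises over sites. At each site one of the half sum and the half difference
  is 0, while the other takes the values 1 and -1 equally often, so every product of powers has a
  nonnegative sum (with \<open>0 ^ 0 = 1\<close>).\<close>

lemma sum_pair_monomial_nonneg:
  assumes "finite V"
  shows "0 \<le> (\<Sum>s\<in>spin_configs V. \<Sum>s'\<in>spin_configs V. pair_monomial V k l s s')"
proof -
  let ?h = "\<lambda>x a b :: real. ((a + b) / 2) ^ k x * ((a - b) / 2) ^ l x"
  have "(\<Sum>s\<in>spin_configs V. \<Sum>s'\<in>spin_configs V. pair_monomial V k l s s')
      = (\<Sum>s\<in>spin_configs V. \<Prod>x\<in>V. \<Sum>b\<in>{-1, 1}. ?h x (s x) b)"
    unfolding pair_monomial_def spin_configs_def using assms
    by (intro sum.cong refl) (subst prod_sum_PiE, auto)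
  also have "\<dots> = (\<Prod>x\<in>V. \<Sum>a\<in>{-1, 1}. \<Sum>b\<in>{-1, 1}. ?h x a b)"
    unfolding spin_configs_def using assms by (subst prod_sum_PiE[symmetric]) auto
  also have "\<dots> \<ge> 0"
    by (intro prod_nonneg) (auto simp: minus_one_power_iff power_0_left)
  finally show ?thesis .
qed

lemma sum_ginibre_cone_nonneg:
  assumes "finite V" "f \<in> monomial_cone (ginibre_monomials V)"
  shows "0 \<le> (\<Sum>\<omega>\<in>spin_configs V \<times> spin_configs V \<times> spin_configs V \<times> spin_configs V. f \<omega>)"
proof (rule monomial_cone_sum_nonneg[OF assms(2)])
  let ?S = "spin_configs V"
  fix g assume "g \<in> ginibre_monomials V"
  then obtain k l m n where
    g: "g = (\<lambda>(s, s', t, t'). pair_monomial V k l s s' * pair_monomial V m n t' t)"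
    unfolding ginibre_monomials_def by auto
  have "sum g (?S \<times> ?S \<times> ?S \<times> ?S)
      = (\<Sum>s\<in>?S. \<Sum>s'\<in>?S. \<Sum>t\<in>?S. \<Sum>t'\<in>?S. pair_monomial V k l s s' * pair_monomial V m n t' t)"
    unfolding g by (simp add: sum.cartesian_product)
  also have "\<dots> = (\<Sum>s\<in>?S. \<Sum>s'\<in>?S. pair_monomial V k l s s')
      * (\<Sum>t\<in>?S. \<Sum>t'\<in>?S. pair_monomial V m n t' t)"
    unfolding sum_distrib_right unfolding sum_distrib_left ..
  also have "(\<Sum>t\<in>?S. \<Sum>t'\<in>?S. pair_monomial V m n t' t)
      = (\<Sum>t'\<in>?S. \<Sum>t\<in>?S. pair_monomial V m n t' t)"
    by (rule sum.swap)
  finally show "0 \<le> sum g (?S \<times> ?S \<times> ?S \<times> ?S)"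
    using sum_pair_monomial_nonneg[OF assms(1)] by simp
qed

lemma ginibre_site:
  assumes "finite V" "x \<in> V"
  shows "(\<lambda>(s, s', t, t'). (s x + s' x) / 2) \<in> monomial_cone (ginibre_monomials V)"
    and "(\<lambda>(s, s', t, t'). (s x - s' x) / 2) \<in> monomial_cone (ginibre_monomials V)"
    and "(\<lambda>(s, s', t, t'). (t' x + t x) / 2) \<in> monomial_cone (ginibre_monomials V)"
    and "(\<lambda>(s, s', t, t'). (t' x - t x) / 2) \<in> monomial_cone (ginibre_monomials V)"
proof -
  let ?z = "\<lambda>_::'a. 0::nat" and ?i = "\<lambda>y. if y = x then 1 else (0::nat)"
  have ind: "pair_monomial V ?i ?z s s' = (s x + s' x) / 2"
    "pair_monomial V ?z ?i s s' = (s x - s' x) / 2" for s s'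
    using prod_power_indicator[OF assms] unfolding pair_monomial_def by simp_all
  have mem: "(\<lambda>(s, s', t, t'). pair_monomial V k l s s' * pair_monomial V m n t' t)
      \<in> monomial_cone (ginibre_monomials V)" for k l m n
    by (rule monomial_cone_base) (auto simp: ginibre_monomials_def)
  show "(\<lambda>(s, s', t, t'). (s x + s' x) / 2) \<in> monomial_cone (ginibre_monomials V)"
    using mem[of ?i ?z ?z ?z] unfolding ind pair_monomial_zero by simp
  show "(\<lambda>(s, s', t, t'). (s x - s' x) / 2) \<in> monomial_cone (ginibre_monomials V)"
    using mem[of ?z ?i ?z ?z] unfolding ind pair_monomial_zero by simp
  show "(\<lambda>(s, s', t, t'). (t' x + t x) / 2) \<in> monomial_cone (ginibre_monomials V)"
    using mem[of ?z ?z ?i ?z] unfolding ind pair_monomial_zero by simp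
  show "(\<lambda>(s, s', t, t'). (t' x - t x) / 2) \<in> monomial_cone (ginibre_monomials V)"
    using mem[of ?z ?z ?z ?i] unfolding ind pair_monomial_zero by simp
qed

text \<open>With \<open>p\<close> and \<open>m\<close> the half sum and half difference at a site,
  the first two functions are \<open>p x * p y + m x * m y\<close> and
  \<open>p x * m y + m x * p y\<close>; no minus sign survives. The other two are the same
  identities for \<open>t'\<close> and \<open>t\<close>.\<close>

lemma ginibre_pair:
  assumes "finite V" "x \<in> V" "y \<in> V"
  shows "(\<lambda>(s, s', t, t'). (s x * s y + s' x * s' y) / 2) \<in> monomial_cone (ginibre_monomials V)"
    and "(\<lambda>(s, s', t, t'). (s x * s y - s' x * s' y) / 2) \<in> monomial_cone (ginibre_monomials V)"
    and "(\<lambda>(s, s', t, t'). (t' x * t' y + t x * t y) / 2) \<in> monomial_cone (ginibre_monomials V)"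
    and "(\<lambda>(s, s', t, t'). (t' x * t' y - t x * t y) / 2) \<in> monomial_cone (ginibre_monomials V)"
proof -
  note X = ginibre_site[OF assms(1,2)] and Y = ginibre_site[OF assms(1,3)]
  show "(\<lambda>(s, s', t, t'). (s x * s y + s' x * s' y) / 2) \<in> monomial_cone (ginibre_monomials V)"
    using monomial_cone_add[OF ginibre.cone_times[OF X(1) Y(1)] ginibre.cone_times[OF X(2) Y(2)]]
    by (rule back_subst[of "\<lambda>f. f \<in> _"]) (auto simp: fun_eq_iff field_simps)
  show "(\<lambda>(s, s', t, t'). (s x * s y - s' x * s' y) / 2) \<in> monomial_cone (ginibre_monomials V)"
    using monomial_cone_add[OF ginibre.cone_times[OF X(1) Y(2)] ginibre.cone_times[OF X(2) Y(1)]]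
    by (rule back_subst[of "\<lambda>f. f \<in> _"]) (auto simp: fun_eq_iff field_simps)
  show "(\<lambda>(s, s', t, t'). (t' x * t' y + t x * t y) / 2) \<in> monomial_cone (ginibre_monomials V)"
    using monomial_cone_add[OF ginibre.cone_times[OF X(3) Y(3)] ginibre.cone_times[OF X(4) Y(4)]]
    by (rule back_subst[of "\<lambda>f. f \<in> _"]) (auto simp: fun_eq_iff field_simps)
  show "(\<lambda>(s, s', t, t'). (t' x * t' y - t x * t y) / 2) \<in> monomial_cone (ginibre_monomials V)"
    using monomial_cone_add[OF ginibre.cone_times[OF X(3) Y(4)] ginibre.cone_times[OF X(4) Y(3)]]
    by (rule back_subst[of "\<lambda>f. f \<in> _"]) (auto simp: fun_eq_iff field_simps)
qed

text \<open>On spin values exactly one of \<open>p\<close>, \<open>m\<close> and exactly one of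
  \<open>q\<close>, \<open>n\<close> is nonzero, and these are 1 or -1. Hence each summand lives on
  one of the four cases, squares serve as indicators, and the formula interpolates the product of
  the two copies' edge weights.\<close>

definition duplicated_edge :: "real \<Rightarrow> real \<Rightarrow> real \<Rightarrow> real \<Rightarrow> real \<Rightarrow> real \<Rightarrow> real" where
  "duplicated_edge j w p m q n = exp (2 * w) *
     ((exp (2 * w) * cosh (4 * j) + exp (- (2 * w))) / 2 * (p * p * (q * q))
      + exp (2 * w) * sinh (4 * j) / 2 * (p * (q * q) + p * p * q)
      + (exp (2 * w) * cosh (4 * j) - exp (- (2 * w))) / 2 * (p * q)
      + cosh (2 * j) * (p * p * (n * n)) + sinh (2 * j) * (p * (n * n))
      + cosh (2 * j) * (m * m * (q * q)) + sinh (2 * j) * (m * m * q)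
      + cosh (2 * w) * (m * m * (n * n)) + sinh (- (2 * w)) * (m * n))"

lemma duplicated_edge_eq:
  assumes "s \<in> {-1, 1}" "s' \<in> {-1, 1}" "t \<in> {-1, 1}" "t' \<in> {-1, 1}"
  shows "exp (j * (s + t) + w * (s * t + 1)) * exp (j * (s' + t') + w * (s' * t' + 1))
    = duplicated_edge j w ((s + s') / 2) ((s - s') / 2) ((t' + t) / 2) ((t' - t) / 2)"
proof -
  have comb: "exp a * (exp b * y) = exp (a + b) * y" for a b y :: real
    by (simp add: exp_add)
  show ?thesis
    using assms unfolding duplicated_edge_def cosh_field_def sinh_field_def
    by (elim insertE emptyE)
       (simp_all add: mult_exp_exp comb distrib_left right_diff_distrib add_divide_distrib diff_divide_distrib)
qed

text \<open>Squaring the hypothesis bounds \<open>exp (- 4 * w)\<close> by the square of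
  \<open>cosh (2 * j)\<close>, which is at most \<open>cosh (4 * j)\<close> by the double-angle
  formula. This is the coefficient of \<open>p * q\<close>.\<close>

lemma duplicated_edge_coeff_nonneg:
  fixes j w :: real
  assumes "exp (- 2 * w) \<le> cosh (2 * j)"
  shows "0 \<le> exp (2 * w) * cosh (4 * j) - exp (- (2 * w))"
proof -
  have "exp (- 2 * w) * exp (- 2 * w) \<le> cosh (2 * j) * cosh (2 * j)"
    using assms by (intro mult_mono) auto
  also have "\<dots> \<le> 2 * (cosh (2 * j) * cosh (2 * j)) - 1"
    using mult_mono[OF cosh_real_ge_1[of "2 * j"] cosh_real_ge_1[of "2 * j"]] by simp
  also have "\<dots> = cosh (4 * j)"
    using cosh_double_cosh[of "2 * j"] by (simp add: power2_eq_square)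
  finally have "exp (2 * w) * (exp (- 2 * w) * exp (- 2 * w)) \<le> exp (2 * w) * cosh (4 * j)"
    by (intro mult_left_mono) auto
  then show ?thesis by (simp add: mult_exp_exp)
qed

text \<open>All coefficients are nonnegative: the \<open>sinh (2 * j)\<close> and
  \<open>sinh (4 * j)\<close> terms by \<open>0 \<le> j\<close>, the \<open>m * n\<close> term by
  \<open>w \<le> 0\<close>, and the \<open>p * q\<close> term by the coupling condition.\<close>

lemma duplicated_edge_in_cone:
  assumes "0 \<le> j" "w \<le> 0" "exp (- 2 * w) \<le> cosh (2 * j)"
    and "finite V" "e \<subseteq> V" "card e = 2"
  shows "(\<lambda>(s, s', t, t'). duplicated_edge j w
      ((edge_spin s e + edge_spin s' e) / 2) ((edge_spin s e - edge_spin s' e) / 2)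
      ((edge_spin t' e + edge_spin t e) / 2) ((edge_spin t' e - edge_spin t e) / 2))
    \<in> monomial_cone (ginibre_monomials V)"
proof -
  obtain x y where e: "e = {x, y}" "x \<noteq> y" using assms(6) by (auto simp: card_2_iff)
  note sites = ginibre_pair[of V x y]
  have "(\<lambda>\<omega>. duplicated_edge j w
      ((\<lambda>(s, s', t, t'). (s x * s y + s' x * s' y) / 2) \<omega>)
      ((\<lambda>(s, s', t, t'). (s x * s y - s' x * s' y) / 2) \<omega>)
      ((\<lambda>(s, s', t, t'). (t' x * t' y + t x * t y) / 2) \<omega>)
      ((\<lambda>(s, s', t, t'). (t' x * t' y - t x * t y) / 2) \<omega>))
    \<in> monomial_cone (ginibre_monomials V)"
    unfolding duplicated_edge_def
    using assms(1,2,4,5) e duplicated_edge_coeff_nonneg[OF assms(3)]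
    by (intro monomial_cone_scale monomial_cone_add ginibre.cone_times sites) simp_all
  then show ?thesis
    unfolding e(1) edge_spin_pair[OF e(2)] by (simp add: case_prod_unfold)
qed

section \<open>Negative correlation between the two spin species\<close>

lemma edge_spin_values:
  assumes "s \<in> spin_configs V" "e \<subseteq> V"
  shows "edge_spin s e \<in> {-1, 1}"
proof (cases "finite e")
  case True
  then show ?thesis using assms(2)
  proof (induction e)
    case (insert x F)
    moreover have "s x \<in> {-1, 1}"
      using assms(1) insert.prems by (auto simp: spin_configs_def PiE_iff)
    ultimately show ?case by (auto simp: edge_spin_def)
  qed (simp add: edge_spin_def)
\<comment> \<open>A product over an infinite set is 1 by default.\<close>
qed (simp add: edge_spin_def)

text \<open>For two independent copies, the unnormalised mean of
  \<open>(s a * s b - s' a * s' b) * (t' c * t' d - t c * t d)\<close> is nonnegative, and expanding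
  it gives twice the difference of the two sides.\<close>

theorem AT_negative_correlation:
  fixes V :: "'a set" and J U :: "'a set \<Rightarrow> real"
  assumes G: "finite_graph V E"
    and J: "\<And>e. e \<in> E \<Longrightarrow> J e \<ge> 0"
    and U: "\<And>e. e \<in> E \<Longrightarrow> U e \<le> 0"
    and JU: "\<And>e. e \<in> E \<Longrightarrow> cosh (2 * J e) \<ge> exp (- 2 * U e)"
    and V: "a \<in> V" "b \<in> V" "c \<in> V" "d \<in> V"
  defines "S \<equiv> spin_configs V"
  shows "AT_partition V E J U * (\<Sum>(s, t)\<in>S \<times> S. AT_weight E J U (s, t) * (s a * s b * (t c * t d)))
    \<le> (\<Sum>(s, t)\<in>S \<times> S. AT_weight E J U (s, t) * (s a * s b))
      * (\<Sum>(s, t)\<in>S \<times> S. AT_weight E J U (s, t) * (t c * t d))"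
proof -
  let ?w = "\<lambda>s t. AT_weight E J U (s, t)"
  have fin: "finite V" and E: "\<And>e. e \<in> E \<Longrightarrow> e \<subseteq> V \<and> card e = 2"
    using G by (auto simp: finite_graph_def)
  let ?f = "\<lambda>(s, s', t, t'). (\<Prod>e\<in>E. duplicated_edge (J e) (U e)
        ((edge_spin s e + edge_spin s' e) / 2) ((edge_spin s e - edge_spin s' e) / 2)
        ((edge_spin t' e + edge_spin t e) / 2) ((edge_spin t' e - edge_spin t e) / 2))
      * ((s a * s b - s' a * s' b) / 2 * ((t' c * t' d - t c * t d) / 2))"
  have "(\<lambda>\<omega>. (\<Prod>e\<in>E. (\<lambda>(s, s', t, t'). duplicated_edge (J e) (U e)
        ((edge_spin s e + edge_spin s' e) / 2) ((edge_spin s e - edge_spin s' e) / 2)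
        ((edge_spin t' e + edge_spin t e) / 2) ((edge_spin t' e - edge_spin t e) / 2)) \<omega>)
      * ((\<lambda>(s, s', t, t'). (s a * s b - s' a * s' b) / 2) \<omega>
        * (\<lambda>(s, s', t, t'). (t' c * t' d - t c * t d) / 2) \<omega>))
      \<in> monomial_cone (ginibre_monomials V)"
    by (intro ginibre.cone_times ginibre.cone_prod duplicated_edge_in_cone ginibre_pair
        J U JU fin V) (use E in auto)
  then have "?f \<in> monomial_cone (ginibre_monomials V)"
    by (simp add: case_prod_unfold)
  then have "0 \<le> sum ?f (S \<times> S \<times> S \<times> S)"
    unfolding S_def using sum_ginibre_cone_nonneg[OF fin] by blast
  also have "sum ?f (S \<times> S \<times> S \<times> S) = (\<Sum>(s, s', t, t')\<in>S \<times> S \<times> S \<times> S.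
      ?w s t * ?w s' t' * ((s a * s b - s' a * s' b) / 2 * ((t' c * t' d - t c * t d) / 2)))"
  proof (intro sum.cong refl, clarify)
    fix s s' t t' assume "s \<in> S" "s' \<in> S" "t \<in> S" "t' \<in> S"
    then have "edge_spin s e \<in> {-1, 1} \<and> edge_spin s' e \<in> {-1, 1}
        \<and> edge_spin t e \<in> {-1, 1} \<and> edge_spin t' e \<in> {-1, 1}" if "e \<in> E" for e
      using E[OF that] edge_spin_values unfolding S_def by blast
    then show "(\<Prod>e\<in>E. duplicated_edge (J e) (U e)
        ((edge_spin s e + edge_spin s' e) / 2) ((edge_spin s e - edge_spin s' e) / 2)
        ((edge_spin t' e + edge_spin t e) / 2) ((edge_spin t' e - edge_spin t e) / 2))
      * ((s a * s b - s' a * s' b) / 2 * ((t' c * t' d - t c * t d) / 2))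
      = ?w s t * ?w s' t' * ((s a * s b - s' a * s' b) / 2 * ((t' c * t' d - t c * t d) / 2))"
      unfolding AT_weight_def
      by (simp add: duplicated_edge_eq[symmetric] prod.distrib del: insert_iff)
  qed
  also have "\<dots> = (\<Sum>s\<in>S. \<Sum>s'\<in>S. \<Sum>t\<in>S. \<Sum>t'\<in>S.
      ?w s t * ?w s' t' * ((s a * s b - s' a * s' b) / 2 * ((t' c * t' d - t c * t d) / 2)))"
    by (simp add: sum.cartesian_product)
  \<comment> \<open>Sums are regrouped by copy, \<open>(s, t)\<close> and \<open>(s', t')\<close>,
    instead of by species.\<close>
  also have "\<dots> = (\<Sum>s\<in>S. \<Sum>t\<in>S. \<Sum>s'\<in>S. \<Sum>t'\<in>S.
      ?w s t * ?w s' t' * ((s a * s b - s' a * s' b) / 2 * ((t' c * t' d - t c * t d) / 2)))"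
    by (intro sum.cong refl sum.swap)
  also have "\<dots> = (\<Sum>x\<in>S \<times> S. \<Sum>y\<in>S \<times> S. AT_weight E J U x * AT_weight E J U y *
      ((fst x a * fst x b - fst y a * fst y b) / 2 * ((snd y c * snd y d - snd x c * snd x d) / 2)))"
    by (simp add: sum.cartesian_product')
  \<comment> \<open>The four products agree in pairs after exchanging the copies \<open>x\<close>
    and \<open>y\<close>.\<close>
  also have "\<dots> = ((\<Sum>x\<in>S \<times> S. AT_weight E J U x * (fst x a * fst x b))
        * (\<Sum>y\<in>S \<times> S. AT_weight E J U y * (snd y c * snd y d))
      + (\<Sum>x\<in>S \<times> S. AT_weight E J U x * (snd x c * snd x d))
        * (\<Sum>y\<in>S \<times> S. AT_weight E J U y * (fst y a * fst y b))
      - (\<Sum>x\<in>S \<times> S. AT_weight E J U x)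
        * (\<Sum>y\<in>S \<times> S. AT_weight E J U y * (fst y a * fst y b * (snd y c * snd y d)))
      - (\<Sum>x\<in>S \<times> S. AT_weight E J U x * (fst x a * fst x b * (snd x c * snd x d)))
        * (\<Sum>y\<in>S \<times> S. AT_weight E J U y)) / 4"
    unfolding sum_product sum.distrib[symmetric] sum_subtractf[symmetric] sum_divide_distrib
    by (intro sum.cong refl) (simp add: field_simps)
  finally show ?thesis
    unfolding AT_partition_def S_def by (simp add: case_prod_unfold mult.commute)
qed

section \<open>Products of spin configurations\<close>

text \<open>Restriction to \<open>V\<close> keeps products extensional, so
  \<open>spin_configs V\<close> becomes a group in which every element is its own inverse.\<close>

definition spin_mult :: "'a set \<Rightarrow> ('a \<Rightarrow> real) \<Rightarrow> ('a \<Rightarrow> real) \<Rightarrow> 'a \<Rightarrow> real" where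
  "spin_mult V s t = restrict (\<lambda>x. s x * t x) V"

lemma spin_values:
  assumes "s \<in> spin_configs V" "x \<in> V"
  shows "s x \<in> {-1, 1}"
  using assms unfolding spin_configs_def by (rule PiE_mem)

lemma spin_square:
  assumes "s \<in> spin_configs V" "x \<in> V"
  shows "s x * s x = 1"
  using spin_values[OF assms] by auto

lemma spin_mult_in:
  assumes "s \<in> spin_configs V" "t \<in> spin_configs V"
  shows "spin_mult V s t \<in> spin_configs V"
proof -
  have "s x * t x \<in> {-1, 1}" if "x \<in> V" for x
    using spin_values[OF assms(1) that] spin_values[OF assms(2) that] by auto
  then show ?thesis unfolding spin_mult_def spin_configs_def by (auto simp: restrict_PiE_iff)
qed

lemma spin_mult_cancel:
  assumes "s \<in> spin_configs V" "t \<in> spin_configs V"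
  shows "spin_mult V s (spin_mult V s t) = t"
proof
  fix x
  show "spin_mult V s (spin_mult V s t) x = t x"
  proof (cases "x \<in> V")
    case True
    then have "spin_mult V s (spin_mult V s t) x = (s x * s x) * t x"
      by (simp add: spin_mult_def)
    then show ?thesis by (simp only: spin_square[OF assms(1) True] mult_1)
  next
    case False
    then have "t x = undefined"
      using assms(2) unfolding spin_configs_def by (rule PiE_arb[rotated])
    with False show ?thesis by (simp add: spin_mult_def)
  qed
qed

text \<open>Translation invariance on this group; it serves both to pass to the overlap of two
  configurations and to flip a component.\<close>

lemma sum_spin_mult:
  assumes "s \<in> spin_configs V"
  shows "(\<Sum>t\<in>spin_configs V. g (spin_mult V s t)) = (\<Sum>t\<in>spin_configs V. g t)"
  by (rule sum.reindex_bij_witness[of _ "spin_mult V s" "spin_mult V s"])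
     (simp_all add: spin_mult_cancel spin_mult_in assms)

lemma edge_spin_mult:
  assumes "e \<subseteq> V"
  shows "edge_spin (spin_mult V s t) e = edge_spin s e * edge_spin t e"
  unfolding edge_spin_def prod.distrib[symmetric]
  using assms by (intro prod.cong) (auto simp: spin_mult_def)

section \<open>Connection and separation\<close>

text \<open>Walks rather than simple paths, so that adding an edge needs no distinctness; loops are
  erased only when a path is required.\<close>

definition linked :: "'a set set \<Rightarrow> ('a \<times> 'a) set" where
  "linked D = {(x, y). {x, y} \<in> D}\<^sup>*"

lemma linked_edge: "{x, y} \<in> D \<Longrightarrow> (z, x) \<in> linked D \<longleftrightarrow> (z, y) \<in> linked D"
  unfolding linked_def
  by (metis (mono_tags, lifting) case_prodI insert_commute mem_Collect_eq rtrancl.rtrancl_into_rtrancl)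

lemma linked_imp_path:
  assumes "(x, y) \<in> linked D"
  shows "\<exists>p. is_path D x y p"
  using assms unfolding linked_def
proof (induction rule: converse_rtrancl_induct)
  case base
  then show ?case by (intro exI[of _ "[y]"]) (simp add: is_path_def)
next
  case (step x z)
  then obtain p where p: "is_path D z y p" by blast
  show ?case
  proof (cases "x \<in> set p")
    case True
    \<comment> \<open>Loop erasure: the part of \<open>p\<close> before its visit to
      \<open>x\<close> is dropped.\<close>
    then obtain as bs where "p = as @ x # bs" by (meson split_list)
    with p have "is_path D x y (x # bs)"
      by (auto simp: is_path_def successively_append_iff)
    then show ?thesis ..
  next
    case False
    with p step.hyps have "is_path D x y (x # p)"
      by (auto simp: is_path_def successively_Cons)
    then show ?thesis ..
  qed
qed

lemma path_linked:
  assumes "is_path D x y p" "w \<in> set p"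
  shows "(w, y) \<in> linked D"
  using assms
proof (induction p arbitrary: x w)
  case (Cons z p)
  show ?case
  proof (cases p)
    case Nil
    then show ?thesis using Cons.prems by (auto simp: is_path_def linked_def)
  next
    case (Cons z' p')
    have tail: "is_path D z' y p" and edge: "{z, z'} \<in> D"
      using Cons.prems Cons by (auto simp: is_path_def)
    have "(w', y) \<in> linked D" if "w' \<in> set p" for w'
      using Cons.IH[OF tail that] .
    moreover have "(z, y) \<in> linked D" if "(z', y) \<in> linked D"
      using that edge unfolding linked_def
      by (auto intro: converse_rtrancl_into_rtrancl)
    ultimately show ?thesis using Cons.prems(2) Cons by auto
  qed
qed simp

text \<open>A path inside \<open>D\<close> is also a path in \<open>E\<close>, so it meets
  \<open>W\<close>; the rest of it still runs inside \<open>D\<close>.\<close>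

lemma separates_linked:
  assumes "separates E W u v" "D \<subseteq> E" "(u, v) \<in> linked D"
  obtains w where "w \<in> W" "(w, v) \<in> linked D"
proof -
  obtain p where p: "is_path D u v p" using linked_imp_path[OF assms(3)] by blast
  then have "is_path E u v p"
    using assms(2) unfolding is_path_def by (auto elim: successively_mono)
  then obtain w where "w \<in> W" "w \<in> set p" using assms(1) by (auto simp: separates_def)
  then show ?thesis using that path_linked[OF p] by blast
qed

lemma linked_spin_eq:
  assumes "(x, y) \<in> linked D" "s \<in> spin_configs V"
    and "\<And>e. e \<in> D \<Longrightarrow> e \<subseteq> V \<and> card e = 2" "\<And>e. e \<in> D \<Longrightarrow> edge_spin s e = 1"
  shows "s x = s y"
  using assms(1) unfolding linked_def
proof induction
  case (step y z)
  then have e: "{y, z} \<in> D" by simp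
  then have "y \<noteq> z" "y \<in> V" "z \<in> V" using assms(3)[OF e] by auto
  moreover have "s y * s z = 1"
    using assms(4)[OF e] \<open>y \<noteq> z\<close> by (simp add: edge_spin_pair)
  ultimately have "s y = s z"
    using spin_values[OF assms(2), of y] spin_values[OF assms(2), of z] by auto
  then show ?case using step.IH by simp
qed simp

section \<open>Expansion over edge subsets\<close>

text \<open>A high-temperature coefficient: for distinct \<open>u\<close>, \<open>v\<close> in a
  finite graph it is \<open>2 ^ card V\<close> if exactly \<open>u\<close> and \<open>v\<close> have
  odd degree in \<open>D\<close>, and 0 otherwise.\<close>

definition edge_subset_corr :: "'a set \<Rightarrow> 'a set set \<Rightarrow> 'a \<Rightarrow> 'a \<Rightarrow> real" where
  "edge_subset_corr V D u v = (\<Sum>s\<in>spin_configs V. s u * s v * (\<Prod>e\<in>D. edge_spin s e))"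

lemma edge_subset_corr_nonneg:
  assumes "finite V" "u \<in> V" "v \<in> V" "\<And>e. e \<in> D \<Longrightarrow> e \<subseteq> V"
  shows "0 \<le> edge_subset_corr V D u v"
  unfolding edge_subset_corr_def using assms
  by (intro Griffiths_first spin.cone_times spin.cone_prod spin_in_cone edge_spin_in_cone) auto

text \<open>Flipping all spins in the component of \<open>u\<close> preserves the edge spins in \<open>D\<close>.\<close>

lemma edge_subset_corr_eq_0:
  assumes "u \<in> V" "v \<in> V" "\<And>e. e \<in> D \<Longrightarrow> e \<subseteq> V \<and> card e = 2" "(u, v) \<notin> linked D"
  shows "edge_subset_corr V D u v = 0"
proof -
  define c where "c = restrict (\<lambda>x. if (u, x) \<in> linked D then - 1 else 1 :: real) V"
  have c: "c \<in> spin_configs V" unfolding c_def spin_configs_def by (auto simp: restrict_PiE_iff)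
  have "edge_spin c e = 1" if e: "e \<in> D" for e
  proof -
    obtain x y where xy: "e = {x, y}" "x \<noteq> y" using assms(3)[OF e] by (auto simp: card_2_iff)
    then show ?thesis
      using linked_edge[of x y D u] assms(3)[OF e] e by (auto simp: edge_spin_pair c_def)
  qed
  then have flip: "(\<Prod>e\<in>D. edge_spin (spin_mult V c s) e) = (\<Prod>e\<in>D. edge_spin s e)" for s
    using assms(3) by (intro prod.cong) (auto simp: edge_spin_mult)
  have "spin_mult V c s u * spin_mult V c s v = - (s u * s v)" for s
    using assms(1,2,4) by (simp add: spin_mult_def c_def linked_def)
  then have "edge_subset_corr V D u v = - edge_subset_corr V D u v"
    unfolding edge_subset_corr_def
    by (subst sum_spin_mult[OF c, symmetric]) (simp add: flip sum_negf)
  then show ?thesis by simp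
qed

text \<open>Even and odd parts in the edge spin \<open>s\<close> of the edge weight at overlap
  \<open>r\<close>. At \<open>r = -1\<close> the weight is 1, so the odd part vanishes; at
  \<open>r = 1\<close> it is \<open>exp (2 * w) * (cosh (2 * j) + s * sinh (2 * j))\<close>.\<close>

definition edge_even :: "real \<Rightarrow> real \<Rightarrow> real \<Rightarrow> real" where
  "edge_even j w r = (exp (2 * w) * cosh (2 * j) + 1) / 2 + (exp (2 * w) * cosh (2 * j) - 1) / 2 * r"

definition edge_odd :: "real \<Rightarrow> real \<Rightarrow> real \<Rightarrow> real" where
  "edge_odd j w r = exp (2 * w) * sinh (2 * j) / 2 * (1 + r)"

lemma AT_edge_eq:
  assumes "s \<in> {-1, 1}" "r \<in> {-1, 1}"
  shows "exp (j * (s + s * r) + w * (s * (s * r) + 1)) = edge_odd j w r * s + edge_even j w r"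
  using assms unfolding edge_even_def edge_odd_def cosh_field_def sinh_field_def
  by (elim insertE emptyE)
     (simp_all add: mult_exp_exp distrib_left right_diff_distrib add_divide_distrib diff_divide_distrib)

text \<open>The coefficient of the product of the edge spins over \<open>D\<close> when the weight
  at fixed overlap \<open>r\<close> is multiplied out.\<close>

definition overlap_weight ::
    "'a set set \<Rightarrow> ('a set \<Rightarrow> real) \<Rightarrow> ('a set \<Rightarrow> real) \<Rightarrow> 'a set set \<Rightarrow> ('a \<Rightarrow> real) \<Rightarrow> real" where
  "overlap_weight E J U D r = (\<Prod>e\<in>D. edge_odd (J e) (U e) (edge_spin r e))
     * (\<Prod>e\<in>E - D. edge_even (J e) (U e) (edge_spin r e))"

text \<open>The coupling condition says exactly that the coefficient of \<open>r\<close> in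
  \<open>edge_even\<close> is nonnegative; \<open>edge_odd\<close> is handled by the sign of
  \<open>J\<close>.\<close>

lemma overlap_weight_in_cone:
  assumes "finite V" and "D \<subseteq> E" and E: "\<And>e. e \<in> E \<Longrightarrow> e \<subseteq> V"
    and J: "\<And>e. e \<in> E \<Longrightarrow> J e \<ge> 0"
    and JU: "\<And>e. e \<in> E \<Longrightarrow> cosh (2 * J e) \<ge> exp (- 2 * U e)"
  shows "overlap_weight E J U D \<in> monomial_cone (spin_monomials V)"
proof -
  have "0 \<le> exp (2 * U e) * cosh (2 * J e) - 1" if "e \<in> E" for e
    using mult_left_mono[OF JU[OF that], of "exp (2 * U e)"] by (simp add: mult_exp_exp)
  then have "(\<lambda>r. (\<Prod>e\<in>D. edge_odd (J e) (U e) (edge_spin r e))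
      * (\<Prod>e\<in>E - D. edge_even (J e) (U e) (edge_spin r e))) \<in> monomial_cone (spin_monomials V)"
    unfolding edge_odd_def edge_even_def using assms(1) J E subsetD[OF assms(2)]
    by (intro spin.cone_times spin.cone_prod monomial_cone_scale monomial_cone_add
        spin.cone_const edge_spin_in_cone) simp_all
  then show ?thesis unfolding overlap_weight_def .
qed

text \<open>Each edge weight is affine in the edge spin of \<open>s\<close>. Multiplying out over
  the set \<open>D\<close> of odd factors decouples the sums over \<open>s\<close> and
  \<open>r\<close>.\<close>

lemma AT_subset_expansion:
  assumes G: "finite_graph V E"
  shows "(\<Sum>s\<in>spin_configs V. \<Sum>r\<in>spin_configs V.
      AT_weight E J U (s, spin_mult V s r) * (s u * s v * h r))
    = (\<Sum>D\<in>Pow E. edge_subset_corr V D u v * (\<Sum>r\<in>spin_configs V. overlap_weight E J U D r * h r))"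
proof -
  let ?S = "spin_configs V"
  have "E \<subseteq> Pow V" "finite V" and E: "\<And>e. e \<in> E \<Longrightarrow> e \<subseteq> V"
    using G by (auto simp: finite_graph_def)
  then have fin: "finite E" using finite_subset by blast
  have weight: "AT_weight E J U (s, spin_mult V s r)
      = (\<Sum>D\<in>Pow E. overlap_weight E J U D r * (\<Prod>e\<in>D. edge_spin s e))"
    if "s \<in> ?S" "r \<in> ?S" for s r
  proof -
    have "AT_weight E J U (s, spin_mult V s r) = (\<Prod>e\<in>E.
        edge_odd (J e) (U e) (edge_spin r e) * edge_spin s e + edge_even (J e) (U e) (edge_spin r e))"
      unfolding AT_weight_def prod.case using that E
      by (intro prod.cong refl, subst AT_edge_eq[symmetric])
         (simp_all add: edge_spin_values edge_spin_mult del: insert_iff)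
    then show ?thesis
      by (simp add: prod_add[OF fin] prod.distrib overlap_weight_def mult_ac)
  qed
  have "(\<Sum>s\<in>?S. \<Sum>r\<in>?S. AT_weight E J U (s, spin_mult V s r) * (s u * s v * h r))
      = (\<Sum>s\<in>?S. \<Sum>r\<in>?S. \<Sum>D\<in>Pow E.
          s u * s v * (\<Prod>e\<in>D. edge_spin s e) * (overlap_weight E J U D r * h r))"
    by (intro sum.cong refl) (simp add: weight sum_distrib_left sum_distrib_right mult_ac)
  also have "\<dots> = (\<Sum>s\<in>?S. \<Sum>D\<in>Pow E. \<Sum>r\<in>?S.
          s u * s v * (\<Prod>e\<in>D. edge_spin s e) * (overlap_weight E J U D r * h r))"
    by (intro sum.cong refl sum.swap)
  also have "\<dots> = (\<Sum>D\<in>Pow E. \<Sum>s\<in>?S. \<Sum>r\<in>?S.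
          s u * s v * (\<Prod>e\<in>D. edge_spin s e) * (overlap_weight E J U D r * h r))"
    by (rule sum.swap)
  also have "\<dots> = (\<Sum>D\<in>Pow E. edge_subset_corr V D u v * (\<Sum>r\<in>?S. overlap_weight E J U D r * h r))"
    unfolding edge_subset_corr_def sum_product ..
  finally show ?thesis .
qed

section \<open>Separation bound with mixed correlations\<close>

lemma sum_pairs_spin_mult:
  "(\<Sum>(s, t)\<in>spin_configs V \<times> spin_configs V. f s t)
     = (\<Sum>s\<in>spin_configs V. \<Sum>r\<in>spin_configs V. f s (spin_mult V s r))"
  unfolding sum.cartesian_product' prod.case
  by (intro sum.cong refl sum_spin_mult[symmetric])

theorem AT_Simon_mixed:
  fixes V W :: "'a set" and J U :: "'a set \<Rightarrow> real"
  assumes G: "finite_graph V E"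
    and J: "\<And>e. e \<in> E \<Longrightarrow> J e \<ge> 0"
    and JU: "\<And>e. e \<in> E \<Longrightarrow> cosh (2 * J e) \<ge> exp (- 2 * U e)"
    and V: "u \<in> V" "v \<in> V" "W \<subseteq> V" and sep: "separates E W u v"
  defines "S \<equiv> spin_configs V"
  shows "(\<Sum>(s, t)\<in>S \<times> S. AT_weight E J U (s, t) * (s u * s v))
    \<le> (\<Sum>w\<in>W. \<Sum>(s, t)\<in>S \<times> S. AT_weight E J U (s, t) * (s u * s w * (t w * t v)))"
proof -
  have fin: "finite V" and E: "\<And>e. e \<in> E \<Longrightarrow> e \<subseteq> V \<and> card e = 2"
    using G by (auto simp: finite_graph_def)
  have finW: "finite W" using V(3) fin by (rule finite_subset)
  have "E \<subseteq> Pow V" using E by auto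
  then have finE: "finite E" using fin finite_subset by auto
  let ?c = "\<lambda>D. edge_subset_corr V D u v" and ?g = "overlap_weight E J U"
  have mixed: "(\<Sum>(s, t)\<in>S \<times> S. AT_weight E J U (s, t) * (s u * s w * (t w * t v)))
      = (\<Sum>D\<in>Pow E. ?c D * (\<Sum>r\<in>S. ?g D r * (r w * r v)))" if "w \<in> W" for w
  proof -
    have w: "w \<in> V" using that V(3) by auto
    have "(\<Sum>(s, t)\<in>S \<times> S. AT_weight E J U (s, t) * (s u * s w * (t w * t v)))
      = (\<Sum>s\<in>S. \<Sum>r\<in>S. AT_weight E J U (s, spin_mult V s r) * (s u * s v * (r w * r v)))"
      unfolding S_def sum_pairs_spin_mult
    proof (intro sum.cong refl)
      fix s r assume s: "s \<in> spin_configs V"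
      \<comment> \<open>The factor \<open>s w * s w = 1\<close> leaves the same
        \<open>s u * s v\<close> for every \<open>w\<close>, so all terms share the coefficients
        \<open>?c D\<close>.\<close>
      have "s u * s w * (spin_mult V s r w * spin_mult V s r v) = (s w * s w) * (s u * s v * (r w * r v))"
        using w V by (simp add: spin_mult_def)
      then show "AT_weight E J U (s, spin_mult V s r) * (s u * s w * (spin_mult V s r w * spin_mult V s r v))
          = AT_weight E J U (s, spin_mult V s r) * (s u * s v * (r w * r v))"
        using spin_square[OF s w] by simp
    qed
    then show ?thesis unfolding S_def AT_subset_expansion[OF G] .
  qed
  have plain: "(\<Sum>(s, t)\<in>S \<times> S. AT_weight E J U (s, t) * (s u * s v))
      = (\<Sum>D\<in>Pow E. ?c D * (\<Sum>r\<in>S. ?g D r * 1))"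
    unfolding S_def sum_pairs_spin_mult AT_subset_expansion[OF G, symmetric] by simp
  have term_le: "?c D * (\<Sum>r\<in>S. ?g D r * 1) \<le> (\<Sum>w\<in>W. ?c D * (\<Sum>r\<in>S. ?g D r * (r w * r v)))"
    if D: "D \<in> Pow E" for D
  proof (cases "(u, v) \<in> linked D")
    case False
    then have "?c D = 0" using V D E by (intro edge_subset_corr_eq_0) auto
    then show ?thesis by simp
  next
    case True
    then obtain w where w: "w \<in> W" "(w, v) \<in> linked D"
      using separates_linked[OF sep] D by blast
    have nonneg: "0 \<le> (\<Sum>r\<in>S. ?g D r * (r w' * r v))" if "w' \<in> W" for w'
      unfolding S_def using that V D E J JU
      by (intro Griffiths_first[OF fin] spin.cone_times spin_in_cone overlap_weight_in_cone fin) auto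
    \<comment> \<open>Either all edges of \<open>D\<close> have overlap 1 and \<open>r\<close> is
      constant along the link from \<open>w\<close> to \<open>v\<close>, or some odd factor vanishes
      and both sides are 0.\<close>
    have "?g D r * (r w * r v) = ?g D r * 1" if r: "r \<in> S" for r
    proof (cases "\<forall>e\<in>D. edge_spin r e = 1")
      case True
      then have "r w = r v"
        using r w(2) D E unfolding S_def by (intro linked_spin_eq[of w v D r V]) auto
      then show ?thesis using spin_square[of r V v] r V unfolding S_def by simp
    next
      case False
      then obtain e where e: "e \<in> D" "edge_spin r e \<noteq> 1" by auto
      then have "edge_spin r e = -1"
        using edge_spin_values[of r V e] r D E unfolding S_def by auto
      then have "edge_odd (J e) (U e) (edge_spin r e) = 0" by (simp add: edge_odd_def)
      moreover have "finite D" using D finE finite_subset by auto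
      ultimately have "(\<Prod>e\<in>D. edge_odd (J e) (U e) (edge_spin r e)) = 0"
        using e(1) by (auto intro: prod_zero)
      then show ?thesis by (simp add: overlap_weight_def)
    qed
    then have "(\<Sum>r\<in>S. ?g D r * 1) = (\<Sum>r\<in>S. ?g D r * (r w * r v))"
      by (intro sum.cong) auto
    \<comment> \<open>One linked \<open>w\<close> already gives the whole left side; the other terms
      are nonnegative.\<close>
    also have "\<dots> \<le> (\<Sum>w\<in>W. \<Sum>r\<in>S. ?g D r * (r w * r v))"
      using member_le_sum[of w W "\<lambda>w. \<Sum>r\<in>S. ?g D r * (r w * r v)"] w(1) finW nonneg by auto
    finally show ?thesis
      unfolding sum_distrib_left[symmetric]
      using V D E by (intro mult_left_mono edge_subset_corr_nonneg fin) auto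
  qed
  have "(\<Sum>D\<in>Pow E. ?c D * (\<Sum>r\<in>S. ?g D r * 1))
      \<le> (\<Sum>D\<in>Pow E. \<Sum>w\<in>W. ?c D * (\<Sum>r\<in>S. ?g D r * (r w * r v)))"
    by (rule sum_mono) (rule term_le)
  also have "\<dots> = (\<Sum>w\<in>W. \<Sum>D\<in>Pow E. ?c D * (\<Sum>r\<in>S. ?g D r * (r w * r v)))"
    by (rule sum.swap)
  finally show ?thesis unfolding plain by (simp add: mixed)
qed

section \<open>Normalisation and conclusion\<close>

lemma AT_corr_eq:
  assumes "finite V"
  shows "AT_corr V E J U x y = (\<Sum>(s, t)\<in>spin_configs V \<times> spin_configs V.
    AT_weight E J U (s, t) * (s x * s y)) / AT_partition V E J U"
  unfolding AT_corr_def AT_expectation_eq_sum[OF assms] sum_divide_distrib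
  by (intro sum.cong) auto

lemma AT_weight_swap: "AT_weight E J U (s, t) = AT_weight E J U (t, s)"
  by (simp add: AT_weight_def add.commute mult.commute)

theorem proposition18:
  fixes V W :: "'a set" and E :: "'a set set"
    and J U :: "'a set \<Rightarrow> real" and u v :: 'a
  assumes "finite_graph V E"
    and "\<And>e. e \<in> E \<Longrightarrow> J e \<ge> 0"
    and "\<And>e. e \<in> E \<Longrightarrow> U e \<le> 0"
    and "\<And>e. e \<in> E \<Longrightarrow> cosh (2 * J e) \<ge> exp (- 2 * U e)"
    and "u \<in> V" and "v \<in> V" and "u \<noteq> v"
    and "W \<subseteq> V" and "separates E W u v"
  shows "AT_corr V E J U u v \<le> (\<Sum>w\<in>W. AT_corr V E J U u w * AT_corr V E J U w v)"
proof -
  let ?S = "spin_configs V" and ?Z = "AT_partition V E J U"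
  have fin: "finite V" using assms(1) by (simp add: finite_graph_def)
  then have Z: "0 < ?Z" by (rule AT_partition_pos)
  have "AT_corr V E J U u v
      \<le> (\<Sum>w\<in>W. \<Sum>(s, t)\<in>?S \<times> ?S. AT_weight E J U (s, t) * (s u * s w * (t w * t v))) / ?Z"
    unfolding AT_corr_eq[OF fin]
    using Z by (intro divide_right_mono AT_Simon_mixed assms) auto
  also have "\<dots> \<le> (\<Sum>w\<in>W. AT_corr V E J U u w * AT_corr V E J U w v)"
    unfolding sum_divide_distrib[of _ W]
  proof (rule sum_mono)
    fix w assume "w \<in> W"
    then have w: "w \<in> V" using assms(8) by auto
    \<comment> \<open>The negative correlation bound produces a correlation of the second species;
      exchange symmetry of the weight identifies it with that of the first.\<close>
    have swap: "(\<Sum>(s, t)\<in>?S \<times> ?S. AT_weight E J U (s, t) * (t w * t v))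
        = (\<Sum>(s, t)\<in>?S \<times> ?S. AT_weight E J U (s, t) * (s w * s v))"
      unfolding sum.cartesian_product' prod.case
      by (subst sum.swap) (simp add: AT_weight_swap)
    have "?Z * (\<Sum>(s, t)\<in>?S \<times> ?S. AT_weight E J U (s, t) * (s u * s w * (t w * t v)))
        \<le> (\<Sum>(s, t)\<in>?S \<times> ?S. AT_weight E J U (s, t) * (s u * s w))
          * (\<Sum>(s, t)\<in>?S \<times> ?S. AT_weight E J U (s, t) * (s w * s v))"
      unfolding swap[symmetric] by (intro AT_negative_correlation assms w)
    from divide_right_mono[OF this, of "?Z * ?Z"]
    show "(\<Sum>(s, t)\<in>?S \<times> ?S. AT_weight E J U (s, t) * (s u * s w * (t w * t v))) / ?Z
        \<le> AT_corr V E J U u w * AT_corr V E J U w v"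
      unfolding AT_corr_eq[OF fin] times_divide_times_eq using Z by simp
  qed
  finally show ?thesis .
qed

end
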